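(* Consider the buffer management problem with packet values $v_1<\dots<v_m$ in which there is exactly one queue for each value $v_i$ (storing only $v_i$-packets) and all queues have the same capacity $B$. Let $r=\max_{1\le i\le m-1} v_i/v_{i+1}$. Then the online algorithm GREEDY is $(1+r)$-competitive, i.e., for every input sequence $\sigma$, $\mathrm{OPT}(\sigma)\le (1+r)\,\mathrm{GREEDY}(\sigma)$.
   Context: Model: packet values are non-negative numbers $v_1<\dots<v_m$. Time is discretized into unit steps. Packets arrive over time (at non-integral times), chosen by an adversary; a $v_i$-packet is destined for the $v_i$-queue. An arriving packet is either admitted to its queue (only if the queue holds fewer than $B$ packets) or rejected. At the end of each time step (a send event) at most one packet is taken from a non-empty queue and transmitted. The benefit of an algorithm on $\sigma$ is the sum of values of transmitted packets. $\mathrm{OPT}(\sigma)$ is the maximum benefit achievable by an offline algorithm knowing $\sigma$ in advance; $\mathrm{GREEDY}(\sigma)$ is GREEDY's benefit. GREEDY: accepts every arriving packet whose queue is not full, and at each send event sends a packet from the non-empty queue of highest value. *)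

theory Defs
  imports Complex_Main
begin

text \<open>
  An input sequence is the chronological list of its events. The events between two
  consecutive \<open>Send\<close>s are the arrivals of one time step, in order of arrival; exact (non-integral)
  arrival times play no further role. Time steps after the last arrival are explicit \<open>Send\<close>s, so
  runs in which the queues are eventually emptied are the input sequences with enough trailing
  \<open>Send\<close>s.
\<close>

datatype event = Arrive nat | Send

definition inputs :: "nat \<Rightarrow> event list set" where
  "inputs m = {\<sigma>. \<forall>i. Arrive i \<in> set \<sigma> \<longrightarrow> i \<in> {1..m}}"

text \<open>
  Packets in the same queue have the same value, so a queue is represented by its length.
\<close>

type_synonym queues = "nat \<Rightarrow> nat"

text \<open>
  \<open>step B v q e q' x\<close>: with capacity \<open>B\<close> and values \<open>v\<close>, an algorithm may react to event \<open>e\<close> by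
  changing the queues from \<open>q\<close> to \<open>q'\<close>, transmitting total value \<open>x\<close>.
\<close>

inductive step :: "nat \<Rightarrow> (nat \<Rightarrow> real) \<Rightarrow> queues \<Rightarrow> event \<Rightarrow> queues \<Rightarrow> real \<Rightarrow> bool"
  for B :: nat and v :: "nat \<Rightarrow> real" where
  admit: "q i < B \<Longrightarrow> step B v q (Arrive i) (q(i := q i + 1)) 0"
| reject: "step B v q (Arrive i) q 0"
| transmit: "0 < q i \<Longrightarrow> step B v q Send (q(i := q i - 1)) (v i)"
| idle: "step B v q Send q 0"

inductive run :: "nat \<Rightarrow> (nat \<Rightarrow> real) \<Rightarrow> queues \<Rightarrow> event list \<Rightarrow> real \<Rightarrow> bool"
  for B :: nat and v :: "nat \<Rightarrow> real" where
  Nil: "run B v q [] 0"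
| Cons: "step B v q e q' x \<Longrightarrow> run B v q' \<sigma> y \<Longrightarrow> run B v q (e # \<sigma>) (x + y)"

inductive_cases run_NilE: "run B v q [] b"
inductive_cases run_ConsE: "run B v q (e # \<sigma>) b"

text \<open>
  An offline algorithm may make any sequence of admissible decisions. By \<open>finite_run\<close> and
  \<open>run_0\<close> below, the set of attainable benefits is finite and non-empty, so the maximum exists;
  by \<open>run_greedy_from\<close>, the benefit of GREEDY is one of them.
\<close>

definition OPT :: "nat \<Rightarrow> (nat \<Rightarrow> real) \<Rightarrow> event list \<Rightarrow> real" where
  "OPT B v \<sigma> = Max {b. run B v (\<lambda>_. 0) \<sigma> b}"

fun greedy_from :: "nat \<Rightarrow> (nat \<Rightarrow> real) \<Rightarrow> queues \<Rightarrow> event list \<Rightarrow> real" where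
  "greedy_from B v q [] = 0"
| "greedy_from B v q (Arrive i # \<sigma>) =
     greedy_from B v (if q i < B then q(i := q i + 1) else q) \<sigma>"
| "greedy_from B v q (Send # \<sigma>) =
     (if \<forall>i. q i = 0 then greedy_from B v q \<sigma>
      else let i = (ARG_MAX v i. 0 < q i) in v i + greedy_from B v (q(i := q i - 1)) \<sigma>)"

definition GREEDY :: "nat \<Rightarrow> (nat \<Rightarrow> real) \<Rightarrow> event list \<Rightarrow> real" where
  "GREEDY B v \<sigma> = greedy_from B v (\<lambda>_. 0) \<sigma>"

definition competitive ::
  "nat \<Rightarrow> nat \<Rightarrow> (nat \<Rightarrow> real) \<Rightarrow> real \<Rightarrow> (event list \<Rightarrow> real) \<Rightarrow> bool" where
  "competitive m B v c alg \<longleftrightarrow> (\<forall>\<sigma>\<in>inputs m. OPT B v \<sigma> \<le> c * alg \<sigma>)"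

lemma finite_step:
  assumes "finite {i. 0 < q i}"
  shows "finite {(q', x). step B v q e q' x}"
proof (cases e)
  case (Arrive i)
  then have "{(q', x). step B v q e q' x} \<subseteq> {(q(i := q i + 1), 0), (q, 0)}"
    by (auto elim: step.cases)
  then show ?thesis
    by (rule finite_subset) simp
next
  case Send
  then have "{(q', x). step B v q e q' x} \<subseteq>
      insert (q, 0) ((\<lambda>i. (q(i := q i - 1), v i)) ` {i. 0 < q i})"
    by (auto elim!: step.cases)
  then show ?thesis
    by (rule finite_subset) (simp add: assms)
qed

lemma step_finite_queues:
  assumes "step B v q e q' x" and "finite {i. 0 < q i}"
  shows "finite {i. 0 < q' i}"
proof -
  have "\<exists>j. {i. 0 < q' i} \<subseteq> insert j {i. 0 < q i}"
    using assms(1) by cases (auto split: if_splits)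
  then show ?thesis
    using assms(2) by (meson finite_insert finite_subset)
qed

lemma finite_run:
  assumes "finite {i. 0 < q i}"
  shows "finite {b. run B v q \<sigma> b}"
  using assms
proof (induction \<sigma> arbitrary: q)
  case Nil
  have "{b. run B v q [] b} \<subseteq> {0}"
    by (auto elim: run_NilE)
  then show ?case
    by (rule finite_subset) simp
next
  case (Cons e \<sigma>)
  let ?S = "{(q', x). step B v q e q' x}"
  have "{b. run B v q (e # \<sigma>) b} \<subseteq> (\<Union>(q', x)\<in>?S. (+) x ` {y. run B v q' \<sigma> y})"
    by (fastforce elim: run_ConsE)
  moreover have "finite (\<Union>(q', x)\<in>?S. (+) x ` {y. run B v q' \<sigma> y})"
    using finite_step[OF Cons.prems] Cons.IH step_finite_queues[OF _ Cons.prems]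
    by (intro finite_UN_I) auto
  ultimately show ?case
    by (rule finite_subset)
qed

lemma run_0: "run B v q \<sigma> 0"
proof (induction \<sigma>)
  case Nil
  show ?case by (rule run.Nil)
next
  case (Cons e \<sigma>)
  have "step B v q e q 0"
    by (cases e) (auto intro: step.intros)
  from run.Cons[OF this Cons.IH] show ?case by simp
qed

lemma run_greedy_from:
  assumes "finite {i. 0 < q i}"
  shows "run B v q \<sigma> (greedy_from B v q \<sigma>)"
  using assms
proof (induction B v q \<sigma> rule: greedy_from.induct)
  case (1 B v q)
  show ?case by (simp add: run.Nil)
next
  case (2 B v q i \<sigma>)
  let ?q = "if q i < B then q(i := q i + 1) else q"
  have s: "step B v q (Arrive i) ?q 0"
    by (auto intro: step.intros simp del: One_nat_def)
  from run.Cons[OF s "2.IH"[OF step_finite_queues[OF s "2.prems"]]] show ?case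
    by simp
next
  case (3 B v q \<sigma>)
  show ?case
  proof (cases "\<forall>i. q i = 0")
    case True
    from run.Cons[OF step.idle "3.IH"(1)[OF True "3.prems"]] True show ?thesis
      by simp
  next
    case False
    define i where "i = (ARG_MAX v i. 0 < q i)"
    have "\<exists>i. is_arg_max v (\<lambda>i. 0 < q i) i"
    proof -
      have ne: "{i. 0 < q i} \<noteq> {}" using False by auto
      then have "Max (v ` {i. 0 < q i}) \<in> v ` {i. 0 < q i}"
        using "3.prems" by (intro Max_in) auto
      then obtain i where "0 < q i" "v i = Max (v ` {i. 0 < q i})" by auto
      then have "is_arg_max v (\<lambda>i. 0 < q i) i"
        using "3.prems" by (auto simp: is_arg_max_linorder)
      then show ?thesis ..
    qed
    then have "0 < q i"
      unfolding i_def arg_max_def by (rule someI2_ex) (simp add: is_arg_max_def)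
    then have s: "step B v q Send (q(i := q i - 1)) (v i)"
      by (rule step.transmit)
    have "greedy_from B v q (Send # \<sigma>) = v i + greedy_from B v (q(i := q i - 1)) \<sigma>"
      using False by (simp only: greedy_from.simps if_False Let_def i_def)
    with run.Cons[OF s "3.IH"(2)[OF False i_def step_finite_queues[OF s "3.prems"]]]
    show ?thesis
      by (simp only:)
  qed
qed

end

(* Potential argument: for the queue lengths p of an arbitrary algorithm and q of GREEDY, let
   Phi p q be the sum of v i * (p i - q i)^+ over all i. Arrivals never increase Phi, since GREEDY
   rejects only when its queue is full. At a send event, let GREEDY send from queue i and the other
   algorithm from queue j. The change of Phi due to GREEDY is at most v i. If j > i, then GREEDY's
   queue j is empty, so the gain v j is paid for by Phi; if j = i, then Phi does not change; if
   j < i, then v j + v i <= (1 + r) * v i. *)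

theory Submission
  imports Defs
begin

text \<open>This is the potential Phi. Subtraction on \<open>nat\<close> truncates at 0, so taking
  it before the conversion to \<open>real\<close> yields the positive part.\<close>

definition surplus :: "nat \<Rightarrow> (nat \<Rightarrow> real) \<Rightarrow> queues \<Rightarrow> queues \<Rightarrow> real" where
  "surplus m v p q = (\<Sum>i\<in>{1..m}. v i * real (p i - q i))"

text \<open>Only the summand at \<open>i\<close> changes. Both functions are updated so that one
  rule covers every event: a side that does not move is updated with its own value.\<close>

lemma surplus_update_le:
  assumes "i \<in> {1..m}" and "v i * real (x - y) \<le> v i * real (p i - q i) + c"
  shows "surplus m v (p(i := x)) (q(i := y)) \<le> surplus m v p q + c"
proof -
  have "surplus m v (p(i := x)) (q(i := y))
      \<le> (\<Sum>l\<in>{1..m}. v l * real (p l - q l) + (if l = i then c else 0))"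
    unfolding surplus_def using assms(2) by (intro sum_mono) auto
  also have "\<dots> = surplus m v p q + c"
    using assms(1) by (simp add: surplus_def sum.distrib)
  finally show ?thesis .
qed

lemma surplus_left_send_le:
  assumes "i \<in> {1..m}" and "0 \<le> v i"
  shows "surplus m v (p(i := p i - 1)) q \<le> surplus m v p q"
  using surplus_update_le[of i m v "p i - 1" "q i" p q 0] assms
  by (simp add: mult_left_mono)

text \<open>Since \<open>q i < p i\<close>, no truncation occurs and the summand drops by exactly
  \<open>v i\<close>, which pays for the packet sent.\<close>

lemma surplus_left_send_exceeding:
  assumes "i \<in> {1..m}" and "q i < p i"
  shows "v i + surplus m v (p(i := p i - 1)) q \<le> surplus m v p q"
proof -
  have "real (p i - 1 - q i) = real (p i - q i) - 1"
    using assms(2) by linarith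
  then show ?thesis
    using surplus_update_le[of i m v "p i - 1" "q i" p q "- v i"] assms
    by (simp add: algebra_simps)
qed

lemma surplus_right_send_le:
  assumes "i \<in> {1..m}" and "0 \<le> v i"
  shows "surplus m v p (q(i := q i - 1)) \<le> surplus m v p q + v i"
proof -
  have "real (p i - (q i - 1)) \<le> real (p i - q i) + 1"
    by linarith
  from mult_left_mono[OF this assms(2)] show ?thesis
    using surplus_update_le[of i m v "p i" "q i - 1" p q "v i"] assms(1)
    by (simp add: algebra_simps)
qed

text \<open>\<open>ARG_MAX\<close> is a choice operator, so its properties rest on a maximum being
  attained; finitely many non-empty queues, at least one of them, ensure this.\<close>

lemma ARG_MAX_nonempty_queue:
  fixes v :: "nat \<Rightarrow> real" and q :: queues
  assumes "finite {i. 0 < q i}" and "\<not> (\<forall>i. q i = 0)"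
  defines "i \<equiv> ARG_MAX v i. 0 < q i"
  shows "0 < q i" and "0 < q j \<Longrightarrow> v j \<le> v i"
proof -
  have "Max (v ` {i. 0 < q i}) \<in> v ` {i. 0 < q i}"
    using assms(1,2) by (intro Max_in) auto
  then obtain k where "0 < q k" "v k = Max (v ` {i. 0 < q i})"
    by auto
  then have "is_arg_max v (\<lambda>i. 0 < q i) k"
    using assms(1) by (auto simp: is_arg_max_linorder)
  then have "is_arg_max v (\<lambda>i. 0 < q i) i"
    unfolding i_def arg_max_def by (rule someI)
  then show "0 < q i" and "0 < q j \<Longrightarrow> v j \<le> v i"
    by (auto simp: is_arg_max_linorder)
qed

text \<open>If GREEDY admits, its queue grows by one and the other by at most one. If GREEDY
  rejects, then \<open>q i\<close> is at least \<open>B\<close>, hence at least \<open>p' i\<close>,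
  and the truncated difference is 0.\<close>

lemma surplus_arrive_le:
  assumes "i \<in> {1..m}" and "0 \<le> v i" and "p i \<le> B"
    and "step B v p (Arrive i) p' x"
  shows "surplus m v p' (if q i < B then q(i := q i + 1) else q) \<le> surplus m v p q"
proof -
  define y where "y = (if q i < B then q i + 1 else q i)"
  have upd: "(if q i < B then q(i := q i + 1) else q) = q(i := y)"
    by (auto simp: y_def)
  have p': "p' = p(i := p' i)" "p' i = p i \<or> p i < B \<and> p' i = p i + 1"
    using assms(4) by (auto elim: step.cases)
  have "p' i - y \<le> p i - q i"
    using p'(2) assms(3) by (auto simp: y_def)
  then have "v i * real (p' i - y) \<le> v i * real (p i - q i) + 0"
    using assms(2) by (simp add: mult_left_mono)
  from surplus_update_le[of i m v "p' i" y p q 0, OF assms(1) this]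
  show ?thesis
    using p'(1) by (simp add: upd)
qed

text \<open>The amortized cost of one send event. Here \<open>ratio\<close> concerns all pairs
  \<open>j < i\<close>, not only neighbours, because the other algorithm may send from any queue
  below \<open>i\<close>.\<close>

lemma surplus_send_le:
  assumes nonneg: "\<And>i. i \<in> {1..m} \<Longrightarrow> 0 \<le> v i"
    and mono: "strict_mono_on {1..m} v" and "0 \<le> r"
    and ratio: "\<And>i j. i \<in> {1..m} \<Longrightarrow> j \<in> {1..m} \<Longrightarrow> j < i \<Longrightarrow> v j \<le> r * v i"
    and i: "i \<in> {1..m}" "0 < q i" "\<And>j. 0 < q j \<Longrightarrow> v j \<le> v i"
    and p: "\<And>j. 0 < p j \<Longrightarrow> j \<in> {1..m}"
    and step: "step B v p Send p' x"
  shows "x + surplus m v p' (q(i := q i - 1)) \<le> (1 + r) * v i + surplus m v p q"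
  using step
proof cases
  case (transmit j)
  have j: "j \<in> {1..m}" using p transmit(3) by blast
  have right: "surplus m v p' (q(i := q i - 1)) \<le> surplus m v p' q + v i"
    using surplus_right_send_le i(1) nonneg by blast
  have rv: "0 \<le> r * v i" using \<open>0 \<le> r\<close> nonneg i(1) by simp
  consider "j < i" | "j = i" | "i < j" by linarith
  then show ?thesis
  proof cases
    case 1
    have "surplus m v p' q \<le> surplus m v p q"
      using surplus_left_send_le j nonneg transmit(1) by blast
    then show ?thesis
      using right ratio[OF i(1) j 1] transmit(2) by (simp add: algebra_simps)
  next
    case 2
    \<comment> \<open>Both queues are non-empty, so their decrements cancel. Bounding the two sends
      separately by \<open>surplus_left_send_le\<close> and \<open>right\<close> would only give
      \<open>2 * v i\<close>.\<close>
    have "p i - 1 - (q i - 1) = p i - q i"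
      using 2 transmit(3) i(2) by linarith
    then have "surplus m v p' (q(i := q i - 1)) \<le> surplus m v p q"
      using surplus_update_le[of i m v "p i - 1" "q i - 1" p q 0] i(1) 2 transmit(1) by simp
    then show ?thesis
      using 2 transmit(2) rv by (simp add: algebra_simps)
  next
    case 3
    have "v i < v j" using strict_mono_onD[OF mono i(1) j 3] .
    \<comment> \<open>A non-empty \<open>q j\<close> would contradict the maximality of
      \<open>v i\<close>, so \<open>q j = 0\<close>.\<close>
    then have "q j < p j" using i(3)[of j] transmit(3) by force
    then show ?thesis
      using surplus_left_send_exceeding[of j m q p v] j right transmit(1,2) rv by (simp add: algebra_simps)
  qed
next
  case idle
  have "0 \<le> r * v i" using \<open>0 \<le> r\<close> nonneg i(1) by simp
  then show ?thesis
    using surplus_right_send_le[of i m v p q] i(1) nonneg idle by (simp add: algebra_simps)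
qed

text \<open>Arbitrary initial queues make the induction over the run possible; the potential bounds
  the lead with which the other algorithm starts. The support conditions ensure that the sum sees
  every packet and that GREEDY's maximum exists.\<close>

lemma run_le_greedy_from:
  assumes nonneg: "\<And>i. i \<in> {1..m} \<Longrightarrow> 0 \<le> v i"
    and mono: "strict_mono_on {1..m} v" and r: "0 \<le> r"
    and ratio: "\<And>i j. i \<in> {1..m} \<Longrightarrow> j \<in> {1..m} \<Longrightarrow> j < i \<Longrightarrow> v j \<le> r * v i"
    and "run B v p \<sigma> b" and "\<sigma> \<in> inputs m"
    and "\<And>i. p i \<le> B" and "\<And>i. 0 < p i \<Longrightarrow> i \<in> {1..m}" and "\<And>i. 0 < q i \<Longrightarrow> i \<in> {1..m}"
  shows "b \<le> (1 + r) * greedy_from B v q \<sigma> + surplus m v p q"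
  using assms(5-)
proof (induction p \<sigma> b arbitrary: q rule: run.induct)
  case (Nil p)
  have "0 \<le> surplus m v p q"
    unfolding surplus_def using nonneg by (intro sum_nonneg) simp
  then show ?case by simp
next
  case (Cons p e p' x \<sigma> y)
  note p_le = Cons.prems(2) and p_supp = Cons.prems(3) and q_supp = Cons.prems(4)
  have \<sigma>: "\<sigma> \<in> inputs m" using Cons.prems(1) by (auto simp: inputs_def)
  have e: "i \<in> {1..m}" if "e = Arrive i" for i
    using Cons.prems(1) that by (simp add: inputs_def)
  have p'_le: "p' i \<le> B" for i
    using Cons.hyps(1) p_le[of i] by cases auto
  have p'_supp: "i \<in> {1..m}" if "0 < p' i" for i
    using Cons.hyps(1) that p_supp[of i] e[of i] by cases (auto split: if_splits)
  have IH: "y \<le> (1 + r) * greedy_from B v q' \<sigma> + surplus m v p' q'"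
    if "\<And>i. 0 < q' i \<Longrightarrow> i \<in> {1..m}" for q'
    using \<sigma> p'_le p'_supp that by (rule Cons.IH)
  show ?case
  proof (cases e)
    case (Arrive i)
    define q' where "q' = (if q i < B then q(i := q i + 1) else q)"
    have "j \<in> {1..m}" if "0 < q' j" for j
      using that q_supp[of j] e[OF Arrive] by (cases "j = i") (auto simp: q'_def split: if_splits)
    then have "y \<le> (1 + r) * greedy_from B v q' \<sigma> + surplus m v p' q'"
      by (rule IH)
    moreover have "surplus m v p' q' \<le> surplus m v p q"
      unfolding q'_def
      using Cons.hyps(1)[unfolded Arrive] e[OF Arrive] nonneg[OF e[OF Arrive]] p_le
      by (intro surplus_arrive_le)
    moreover have "x = 0"
      using Cons.hyps(1) Arrive by (auto elim: step.cases)
    ultimately show ?thesis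
      by (simp add: Arrive q'_def)
  next
    case Send
    show ?thesis
    proof (cases "\<forall>i. q i = 0")
      case True
      \<comment> \<open>GREEDY earns nothing here, but every packet of the other algorithm is in
        excess, so the potential alone pays for \<open>x\<close>.\<close>
      have "x + surplus m v p' q \<le> surplus m v p q"
        using Cons.hyps(1) unfolding Send
      proof cases
        case (transmit j)
        then show ?thesis
          using surplus_left_send_exceeding[of j m q p v] p_supp[of j] True by simp
      qed simp
      moreover have greedy: "greedy_from B v q (Send # \<sigma>) = greedy_from B v q \<sigma>"
        by (simp only: greedy_from.simps if_P[OF True])
      moreover have "y \<le> (1 + r) * greedy_from B v q \<sigma> + surplus m v p' q"
        using q_supp by (rule IH)
      ultimately show ?thesis
        unfolding Send greedy by linarith
    next
      case False
      define i where "i = (ARG_MAX v i. 0 < q i)"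
      have "finite {i. 0 < q i}"
        by (rule finite_subset[of _ "{1..m}"]) (use q_supp in auto)
      note i = ARG_MAX_nonempty_queue[OF this False, where v = v, folded i_def]
      have "j \<in> {1..m}" if "0 < (q(i := q i - 1)) j" for j
        using that q_supp[of j] by (auto split: if_splits)
      then have "y \<le> (1 + r) * greedy_from B v (q(i := q i - 1)) \<sigma>
          + surplus m v p' (q(i := q i - 1))"
        by (rule IH)
      moreover have "x + surplus m v p' (q(i := q i - 1)) \<le> (1 + r) * v i + surplus m v p q"
        using nonneg mono r ratio q_supp[OF i(1)] i p_supp Cons.hyps(1)[unfolded Send]
        by (rule surplus_send_le)
      moreover have greedy:
          "greedy_from B v q (Send # \<sigma>) = v i + greedy_from B v (q(i := q i - 1)) \<sigma>"
        using False by (simp only: greedy_from.simps if_False Let_def i_def)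
      ultimately show ?thesis
        unfolding Send greedy distrib_left by linarith
    qed
  qed
qed

theorem theorem2:
  fixes m B :: nat and v :: "nat \<Rightarrow> real" and r :: real
  assumes "2 \<le> m"
    and "\<forall>i\<in>{1..m}. 0 \<le> v i"
    and "strict_mono_on {1..m} v"
    and "r = Max ((\<lambda>i. v i / v (i + 1)) ` {1..m - 1})"
  shows "competitive m B v (1 + r) (GREEDY B v)"
proof -
  have nonneg: "0 \<le> v i" if "i \<in> {1..m}" for i
    using assms(2) that by blast
  have quotient_le: "v i / v (i + 1) \<le> r" if "i \<in> {1..m - 1}" for i
    unfolding assms(4) using that by (intro Max_ge) auto
  \<comment> \<open>As \<open>2 \<le> m\<close>, this quotient is among those whose maximum is
    \<open>r\<close>.\<close>
  have "0 \<le> v 1 / v 2"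
    using nonneg assms(1) by simp
  also have "\<dots> \<le> r"
    using quotient_le[of 1] assms(1) by (simp add: numeral_2_eq_2)
  finally have "0 \<le> r" .
  \<comment> \<open>The bound for neighbours extends upwards because
    \<open>v (j + 1) \<le> v i\<close>. The denominator \<open>v (j + 1)\<close> is positive, as it
    exceeds \<open>v j \<ge> 0\<close>.\<close>
  have ratio: "v j \<le> r * v i" if "i \<in> {1..m}" "j \<in> {1..m}" "j < i" for i j
  proof -
    have "v j < v (j + 1)"
      using that by (intro strict_mono_onD[OF assms(3)]) auto
    moreover have "v (j + 1) \<le> v i"
      using that by (intro strict_mono_on_leD[OF assms(3)]) auto
    moreover have "0 \<le> v j" using nonneg that(2) .
    moreover have "v j / v (j + 1) \<le> r"
      using quotient_le that by simp
    ultimately have "v j \<le> r * v (j + 1)"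
      by (simp add: pos_divide_le_eq)
    also have "\<dots> \<le> r * v i"
      using \<open>v (j + 1) \<le> v i\<close> \<open>0 \<le> r\<close> by (rule mult_left_mono)
    finally show ?thesis .
  qed
  have "OPT B v \<sigma> \<le> (1 + r) * GREEDY B v \<sigma>" if "\<sigma> \<in> inputs m" for \<sigma>
  proof -
    have "b \<le> (1 + r) * GREEDY B v \<sigma>" if "run B v (\<lambda>_. 0) \<sigma> b" for b
    proof -
      \<comment> \<open>Both algorithms start with empty queues, so the initial potential
        vanishes.\<close>
      have "b \<le> (1 + r) * greedy_from B v (\<lambda>_. 0) \<sigma> + surplus m v (\<lambda>_. 0) (\<lambda>_. 0)"
        using nonneg assms(3) \<open>0 \<le> r\<close> ratio that \<open>\<sigma> \<in> inputs m\<close>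
        by (rule run_le_greedy_from) simp_all
      then show ?thesis
        by (simp add: GREEDY_def surplus_def)
    qed
    then show ?thesis
      \<comment> \<open>Bounding \<open>Max\<close> by its elements requires the set of benefits to
        be finite and non-empty.\<close>
      unfolding OPT_def using finite_run[of "\<lambda>_. 0" B v \<sigma>] run_0[of B v _ \<sigma>]
      by (subst Max_le_iff) (simp_all, blast)
  qed
  then show ?thesis
    by (simp add: competitive_def)
qed

end
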